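(* Let $\{(b_i,d_i)\}_{i=1}^N$ be a persistence diagram, let $m\in\mathbb{R}$ and let $k\ge 1$ be an integer. Let $t_{(1,m)}\ge t_{(2,m)}\ge\cdots\ge t_{(N,m)}$ be the tent values $\ell_1(m),\dots,\ell_N(m)$ sorted in decreasing order, set $t_{(N+1,m)}=0$, and let $r_i\in\{1,\dots,N\}$ be the rank of player $i$ in this order (so $\ell_i(m)=t_{(r_i,m)}$, rank $1$ being the largest). Then the Shapley value of player $i$ in the game $v_{(k,m)}$ is \[\varphi_i(v_{(k,m)})=\sum_{j=\max(r_i,k)}^{N}\frac{t_{(j,m)}-t_{(j+1,m)}}{j}\] for every $i\in\{1,\dots,N\}$.
   Context: A persistence diagram here is a finite indexed family of points $(b_i,d_i)\in\mathbb{R}^2$ with $b_i\le d_i$, $i=1,\dots,N$, $N\ge1$. The tent function of point $i$ is $\ell_i(m)=\min(\max(0,m-b_i),\max(0,d_i-m))\ge 0$. For an integer $k\ge1$ and $m\in\mathbb{R}$, the landscape game $v_{(k,m)}$ on the player set $\{1,\dots,N\}$ is the set function $v_{(k,m)}(S)=$ the $k$-th largest value (with multiplicity) among $\{\ell_i(m): i\in S\}$ if $|S|\ge k$, and $v_{(k,m)}(S)=0$ if $|S|<k$. The Shapley value of player $i$ in a game $v:2^{\{1,\dots,N\}}\to\mathbb{R}$ is \[\varphi_i(v)=\frac1N\sum_{S\subset\{1,\dots,N\}\setminus\{i\}}\binom{N-1}{|S|}^{-1}\bigl(v(S\cup\{i\})-v(S)\bigr).\] Ties in the ordering may be broken arbitrarily.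 Empty sums (when $k>N$) are $0$. *)

theory Defs
  imports Complex_Main "HOL-Library.Multiset"
begin

(* The points are (b i, d i) for i in {1..N}; values of b and d at other indices are irrelevant. *)
definition persistence_diagram :: "nat \<Rightarrow> (nat \<Rightarrow> real) \<Rightarrow> (nat \<Rightarrow> real) \<Rightarrow> bool" where
  "persistence_diagram N b d \<longleftrightarrow> N \<ge> 1 \<and> (\<forall>i\<in>{1..N}. b i \<le> d i)"

definition tent :: "(nat \<Rightarrow> real) \<Rightarrow> (nat \<Rightarrow> real) \<Rightarrow> nat \<Rightarrow> real \<Rightarrow> real" where
  "tent b d i m = min (max 0 (m - b i)) (max 0 (d i - m))"

(* The family (f i), i in S, in decreasing order, repeated values kept; for finite S. *)
definition values_desc :: "('a \<Rightarrow> real) \<Rightarrow> 'a set \<Rightarrow> real list" where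
  "values_desc f S = rev (sorted_list_of_multiset (image_mset f (mset_set S)))"

(* List positions start at 0, so the k-th largest value (k at least 1) is at position k - 1. *)
definition landscape_game ::
  "(nat \<Rightarrow> real) \<Rightarrow> (nat \<Rightarrow> real) \<Rightarrow> nat \<Rightarrow> real \<Rightarrow> nat set \<Rightarrow> real" where
  "landscape_game b d k m S =
     (if k \<le> card S then values_desc (\<lambda>i. tent b d i m) S ! (k - 1) else 0)"

definition shapley_value :: "nat \<Rightarrow> (nat set \<Rightarrow> real) \<Rightarrow> nat \<Rightarrow> real" where
  "shapley_value N v i =
     1 / real N * (\<Sum>S\<in>Pow ({1..N} - {i}).
       inverse (real ((N - 1) choose card S)) * (v (insert i S) - v S))"

(* Meaningful for j at least 1; the value is 0 at j = N + 1. *)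
definition sorted_tent ::
  "nat \<Rightarrow> (nat \<Rightarrow> real) \<Rightarrow> (nat \<Rightarrow> real) \<Rightarrow> real \<Rightarrow> nat \<Rightarrow> real" where
  "sorted_tent N b d m j =
     (if j \<le> N then values_desc (\<lambda>i. tent b d i m) {1..N} ! (j - 1) else 0)"

(* Any bijection that lists the tent values in decreasing order is a ranking:
   this leaves the order of tied players arbitrary. *)
definition tent_ranking ::
  "nat \<Rightarrow> (nat \<Rightarrow> real) \<Rightarrow> (nat \<Rightarrow> real) \<Rightarrow> real \<Rightarrow> (nat \<Rightarrow> nat) \<Rightarrow> bool" where
  "tent_ranking N b d m r \<longleftrightarrow>
     bij_betw r {1..N} {1..N} \<and> (\<forall>i\<in>{1..N}. tent b d i m = sorted_tent N b d m (r i))"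

end

theory Submission
  imports Defs
begin

text \<open>
  Let \<open>T\<^sub>j\<close> be the set of the \<open>j\<close> players of largest tent value. The landscape game is the
  combination, with coefficients \<open>t\<^sub>j - t\<^sub>j\<^sub>+\<^sub>1\<close>, of the quota games ``at least \<open>k\<close> members of \<open>T\<^sub>j\<close>
  are present''. In such a game the players outside \<open>T\<^sub>j\<close> are null and can be discarded, and the
  members of \<open>T\<^sub>j\<close> share the value \<open>1\<close> equally if \<open>k \<le> j\<close>. Linearity of the Shapley value gives
  the formula.
\<close>

section \<open>Weights of coalitions in the Shapley value\<close>

text \<open>Here \<open>n\<close> counts the other players, so it is \<open>N - 1\<close> in a game with \<open>N\<close> players.\<close>
definition shapley_weight :: "nat \<Rightarrow> nat \<Rightarrow> real" where
  "shapley_weight n s = inverse (real (n choose s)) / real (Suc n)"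

text \<open>\<open>shapley_weight n s\<close> is the probability that, in a random order of
  \<open>Suc n\<close> players, the predecessors of a fixed player are a given set of size
  \<open>s\<close>. A newcomer comes either after or before the fixed player, which splits this
  event in two.\<close>

lemma shapley_weight_add:
  assumes "s \<le> n"
  shows "shapley_weight (Suc n) s + shapley_weight (Suc n) (Suc s) = shapley_weight n s"
proof -
  define c where "c = real (n choose s)"
  have c: "c > 0" using assms by (simp add: c_def)
  have up: "real (Suc n choose Suc s) = real (Suc n) * c / real (Suc s)"
    using arg_cong[OF Suc_times_binomial[of s n], of real]
    by (simp add: c_def field_simps del: binomial_Suc_Suc)
  have "Suc n * (n choose s) = (Suc n - s) * (Suc n choose s)"
    using binomial_absorb_comp[of "Suc n" s] by simp
  from arg_cong[OF this, of real]
  have stay: "real (Suc n choose s) = real (Suc n) * c / (real (Suc n) - real s)"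
    using assms by (simp add: c_def field_simps of_nat_diff del: binomial_Suc_Suc)
  \<comment> \<open>Over the common denominator the numerators add up to \<open>n + 2\<close>, which
    cancels the factor \<open>Suc (Suc n)\<close>.\<close>
  have "shapley_weight (Suc n) s + shapley_weight (Suc n) (Suc s) =
      ((real (Suc n) - real s) + real (Suc s)) / (real (Suc n) * c * real (Suc (Suc n)))"
    unfolding shapley_weight_def up stay
    by (simp only: inverse_divide divide_divide_eq_left add_divide_distrib)
  also have "\<dots> = shapley_weight n s"
    using c by (simp add: shapley_weight_def c_def field_simps del: of_nat_Suc) (simp add: algebra_simps)
  finally show ?thesis .
qed

lemma sum_Pow_insert:
  fixes g :: "'a set \<Rightarrow> 'b::comm_monoid_add"
  assumes "finite A" "x \<notin> A"
  shows "(\<Sum>S\<in>Pow (insert x A). g S) = (\<Sum>S\<in>Pow A. g S + g (insert x S))"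
proof -
  have "inj_on (insert x) (Pow A)"
    using assms(2) by (intro inj_onI) (metis PowD insert_ident subsetD)
  moreover have "Pow A \<inter> insert x ` Pow A = {}"
    using assms(2) by auto
  ultimately show ?thesis
    using assms(1) by (simp add: Pow_insert sum.union_disjoint sum.reindex sum.distrib)
qed

text \<open>The members of \<open>B\<close> act as null players and are removed one at a time:
  \<open>S\<close> and \<open>insert x S\<close> carry the same factor \<open>F\<close>, and
  \<open>shapley_weight_add\<close> merges their weights.\<close>

lemma sum_shapley_weight_discard:
  assumes "finite B" "finite A" "A \<inter> B = {}"
  shows "(\<Sum>S\<in>Pow (A \<union> B). shapley_weight (card (A \<union> B)) (card S) * F (S \<inter> A)) =
    (\<Sum>S\<in>Pow A. shapley_weight (card A) (card S) * F S)"
  using assms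
proof (induction B rule: finite_induct)
  case empty
  show ?case by (intro sum.cong) (auto simp: Int_absorb2)
next
  case (insert x B)
  define C where "C = A \<union> B"
  have C: "finite C" "x \<notin> C" "x \<notin> A" using insert by (auto simp: C_def)
  have "(\<Sum>S\<in>Pow (A \<union> insert x B). shapley_weight (card (A \<union> insert x B)) (card S) * F (S \<inter> A)) =
      (\<Sum>S\<in>Pow (insert x C). shapley_weight (Suc (card C)) (card S) * F (S \<inter> A))"
    using C by (simp add: C_def)
  also have "\<dots> = (\<Sum>S\<in>Pow C. shapley_weight (card C) (card S) * F (S \<inter> A))"
    unfolding sum_Pow_insert[OF C(1,2)]
  proof (rule sum.cong[OF refl])
    fix S assume "S \<in> Pow C"
    then have S: "finite S" "x \<notin> S" "card S \<le> card C"
      using C by (auto intro: finite_subset card_mono)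
    show "shapley_weight (Suc (card C)) (card S) * F (S \<inter> A) +
        shapley_weight (Suc (card C)) (card (insert x S)) * F (insert x S \<inter> A) =
        shapley_weight (card C) (card S) * F (S \<inter> A)"
      using S C(3) by (simp add: shapley_weight_add[OF S(3), symmetric] distrib_right)
  qed
  also have "\<dots> = (\<Sum>S\<in>Pow A. shapley_weight (card A) (card S) * F S)"
    using insert by (simp add: C_def)
  finally show ?case .
qed

text \<open>In a random order of \<open>A\<close> and one further player, that player is equally
  likely to have any number of predecessors from 0 to \<open>card A\<close>.\<close>

lemma sum_shapley_weight_card_eq:
  assumes "finite A"
  shows "(\<Sum>S\<in>Pow A. shapley_weight (card A) (card S) * of_bool (card S = q)) =
    (if q \<le> card A then 1 / real (Suc (card A)) else 0)"
proof -
  have "(\<Sum>S\<in>Pow A. shapley_weight (card A) (card S) * of_bool (card S = q)) =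
      (\<Sum>S\<in>{S. S \<subseteq> A \<and> card S = q}. shapley_weight (card A) q)"
    using assms by (intro sum.mono_neutral_cong_right) auto
  also have "\<dots> = real (card A choose q) * shapley_weight (card A) q"
    using assms by (simp add: n_subsets)
  also have "\<dots> = (if q \<le> card A then 1 / real (Suc (card A)) else 0)"
    by (auto simp: shapley_weight_def)
  finally show ?thesis .
qed

section \<open>Linearity of the Shapley value and its value on quota games\<close>

lemma shapley_value_altdef:
  assumes "i \<in> {1..N}"
  shows "shapley_value N v i =
    (\<Sum>S\<in>Pow ({1..N} - {i}). shapley_weight (card ({1..N} - {i})) (card S) * (v (insert i S) - v S))"
  using assms by (simp add: shapley_value_def shapley_weight_def sum_distrib_left mult_ac divide_inverse)

lemma shapley_value_cong:
  assumes "i \<in> {1..N}" "\<And>S. S \<subseteq> {1..N} \<Longrightarrow> v S = w S"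
  shows "shapley_value N v i = shapley_value N w i"
proof -
  have "v (insert i S) = w (insert i S)" "v S = w S" if "S \<in> Pow ({1..N} - {i})" for S
    using that assms(1) by (auto intro!: assms(2))
  then show ?thesis
    unfolding shapley_value_def by (intro arg_cong2[where f = "(*)"] sum.cong refl) simp
qed

lemma shapley_value_sum:
  assumes "i \<in> {1..N}"
  shows "shapley_value N (\<lambda>S. \<Sum>j\<in>J. c j * u j S) i = (\<Sum>j\<in>J. c j * shapley_value N (u j) i)"
  unfolding shapley_value_altdef[OF assms] sum_subtractf[symmetric] right_diff_distrib[symmetric]
    sum_distrib_left
  by (subst sum.swap) (simp add: mult_ac)

lemma shapley_value_quota_game:
  assumes "T \<subseteq> {1..N}" "i \<in> {1..N}" "k \<ge> 1"
  shows "shapley_value N (\<lambda>S. of_bool (k \<le> card (S \<inter> T))) i =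
    (if i \<in> T \<and> k \<le> card T then 1 / real (card T) else 0)"
proof (cases "i \<in> T")
  \<comment> \<open>Adding \<open>i\<close> leaves \<open>S \<inter> T\<close> unchanged, so every
    marginal contribution vanishes.\<close>
  case False
  then show ?thesis
    by (simp add: shapley_value_def)
next
  case True
  define A where "A = T - {i}"
  define B where "B = {1..N} - T"
  have fin: "finite T" "finite A" "finite B" and AB: "A \<inter> B = {}" "A \<union> B = {1..N} - {i}"
    using assms True by (auto simp: A_def B_def intro: finite_subset)
  have card_T: "card T = Suc (card A)"
    using card.remove[OF fin(1) True] by (simp add: A_def)
  \<comment> \<open>Player \<open>i\<close> is pivotal exactly when \<open>k - 1\<close> other
    members of \<open>T\<close> are present; \<open>k \<ge> 1\<close> makes the subtraction
    exact.\<close>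
  have "of_bool (k \<le> card (insert i S \<inter> T)) - of_bool (k \<le> card (S \<inter> T)) =
      (of_bool (card (S \<inter> A) = k - 1) :: real)" if "S \<in> Pow (A \<union> B)" for S
  proof -
    have "S \<inter> T = S \<inter> A" "insert i S \<inter> T = insert i (S \<inter> A)" "i \<notin> S \<inter> A"
      using that True AB by (auto simp: A_def)
    then show ?thesis using fin assms(3) by auto
  qed
  then have "shapley_value N (\<lambda>S. of_bool (k \<le> card (S \<inter> T))) i =
      (\<Sum>S\<in>Pow (A \<union> B). shapley_weight (card (A \<union> B)) (card S) * of_bool (card (S \<inter> A) = k - 1))"
    unfolding shapley_value_altdef[OF assms(2)] AB(2)[symmetric] by (intro sum.cong refl) simp
  also have "\<dots> = (\<Sum>S\<in>Pow A. shapley_weight (card A) (card S) * of_bool (card S = k - 1))"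
    by (rule sum_shapley_weight_discard) (use fin AB in auto)
  also have "\<dots> = (if k \<le> card T then 1 / real (card T) else 0)"
    unfolding sum_shapley_weight_card_eq[OF fin(2)] card_T using assms(3) by auto
  finally show ?thesis using True by simp
qed

section \<open>Order statistics of sorted lists\<close>

text \<open>The entries \<open>\<le> y\<close> form an initial segment of a sorted list, so a
  position lies in it iff it is smaller than the length of the segment.\<close>

lemma sorted_nth_le_iff:
  fixes xs :: "'a::linorder list"
  assumes "sorted xs" "n < length xs"
  shows "xs ! n \<le> y \<longleftrightarrow> n < length (filter (\<lambda>x. x \<le> y) xs)"
  using assms
proof (induction xs arbitrary: n)
  case (Cons x xs)
  have "filter (\<lambda>x. x \<le> y) xs = []" if "\<not> x \<le> y"
    using Cons.prems(1) that by (fastforce simp: filter_empty_conv)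
  then show ?case
    using Cons by (cases n) (auto dest: nth_mem)
qed simp

lemma nth_sorted_list_of_set_le_iff:
  fixes A :: "'a::linorder set"
  assumes "finite A" "n < card A"
  shows "sorted_list_of_set A ! n \<le> y \<longleftrightarrow> n < card {x \<in> A. x \<le> y}"
proof -
  have "card {x \<in> A. x \<le> y} = length (filter (\<lambda>x. x \<le> y) (sorted_list_of_set A))"
    using assms(1) distinct_card[of "filter (\<lambda>x. x \<le> y) (sorted_list_of_set A)"] by simp
  then show ?thesis
    using assms by (simp add: sorted_nth_le_iff)
qed

lemma length_values_desc:
  assumes "finite S"
  shows "length (values_desc f S) = card S"
proof -
  have "length (values_desc f S) = size (mset (sorted_list_of_multiset (image_mset f (mset_set S))))"
    by (simp add: values_desc_def del: mset_sorted_list_of_multiset)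
  then show ?thesis by simp
qed

lemma values_desc_antimono:
  assumes "finite S" "p \<le> q" "q < card S"
  shows "values_desc f S ! q \<le> values_desc f S ! p"
proof -
  have "sorted (rev (values_desc f S))"
    by (simp add: values_desc_def)
  then show ?thesis
    using assms by (simp add: sorted_rev_iff_nth_mono length_values_desc)
qed

text \<open>Replaces sorting by value with sorting by rank: ranks are distinct even where values
  tie.\<close>

lemma values_desc_eq_map:
  fixes r :: "'a \<Rightarrow> 'b::linorder"
  assumes "finite S" "inj_on r S" "\<And>i. i \<in> S \<Longrightarrow> f i = t (r i)"
    and "\<And>x y. x \<in> r ` S \<Longrightarrow> y \<in> r ` S \<Longrightarrow> x \<le> y \<Longrightarrow> t y \<le> t x"
  shows "values_desc f S = map t (sorted_list_of_set (r ` S))"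
proof -
  define xs where "xs = sorted_list_of_set (r ` S)"
  have "image_mset f (mset_set S) = image_mset t (image_mset r (mset_set S))"
    using assms(1,3) by (auto simp: multiset.map_comp intro!: image_mset_cong)
  also have "image_mset r (mset_set S) = mset xs"
    using assms(1,2) by (simp add: image_mset_mset_set xs_def flip: sorted_list_of_mset_set)
  \<comment> \<open>\<open>t\<close> decreases along \<open>xs\<close>, so the reversed list is
    already ascending and the sort in \<open>values_desc\<close> leaves it fixed.\<close>
  also have "image_mset t (mset xs) = mset (rev (map t xs))"
    by simp
  finally have "values_desc f S = rev (sort (rev (map t xs)))"
    unfolding values_desc_def by (metis sorted_list_of_multiset_mset)
  moreover have "sorted (rev (map t xs))"
    unfolding sorted_rev_iff_nth_mono
  proof (intro allI impI)
    fix p q assume pq: "p \<le> q" "q < length (map t xs)"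
    have "sorted xs" "set xs = r ` S"
      using assms(1) by (auto simp: xs_def)
    then show "map t xs ! q \<le> map t xs ! p"
      using pq by (auto intro!: assms(4) simp: sorted_nth_mono simp flip: \<open>set xs = r ` S\<close>)
  qed
  ultimately show ?thesis
    by (simp add: sorted_sort_id xs_def)
qed

section \<open>Decomposition of the landscape game and the resulting formula\<close>

lemma sorted_tent_antimono:
  assumes "1 \<le> x" "x \<le> y" "y \<le> N"
  shows "sorted_tent N b d m y \<le> sorted_tent N b d m x"
  using assms by (auto simp: sorted_tent_def intro!: values_desc_antimono)

text \<open>If \<open>p\<close> is the \<open>k\<close>-th smallest rank in \<open>S\<close>, the
  game has value \<open>t p\<close>, a telescoping sum over \<open>j \<ge> p\<close>; and
  \<open>p \<le> j\<close> says that at least \<open>k\<close> members of \<open>S\<close> have rank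
  at most \<open>j\<close>.\<close>

lemma landscape_game_eq_sum_quota_games:
  assumes rank: "tent_ranking N b d m r" and k: "k \<ge> 1" and S: "S \<subseteq> {1..N}"
  shows "landscape_game b d k m S =
    (\<Sum>j = 1..N. (sorted_tent N b d m j - sorted_tent N b d m (j + 1)) *
      of_bool (k \<le> card (S \<inter> {i \<in> {1..N}. r i \<le> j})))"
proof -
  define t where "t = sorted_tent N b d m"
  have r: "inj_on r {1..N}" "r ` {1..N} = {1..N}" and t_r: "\<And>i. i \<in> {1..N} \<Longrightarrow> tent b d i m = t (r i)"
    using rank by (auto simp: tent_ranking_def bij_betw_def t_def)
  have inj: "inj_on r S" and fin: "finite S" and rS: "r ` S \<subseteq> {1..N}"
    using S r by (auto intro: inj_on_subset finite_subset)
  have card_le: "card {x \<in> r ` S. x \<le> j} = card (S \<inter> {i \<in> {1..N}. r i \<le> j})" for j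
  proof -
    have "{x \<in> r ` S. x \<le> j} = r ` (S \<inter> {i \<in> {1..N}. r i \<le> j})"
      using S by auto
    then show ?thesis
      using inj by (simp add: card_image inj_on_Int)
  qed
  show ?thesis
  proof (cases "k \<le> card S")
    case False
    \<comment> \<open>With fewer than \<open>k\<close> players no quota is met, so both sides are
      0.\<close>
    have "card (S \<inter> {i \<in> {1..N}. r i \<le> j}) \<le> card S" for j
      using fin by (intro card_mono) auto
    then have "\<not> k \<le> card (S \<inter> {i \<in> {1..N}. r i \<le> j})" for j
      using False by (meson le_trans)
    then show ?thesis
      using False by (simp add: landscape_game_def)
  next
    case True
    define p where "p = sorted_list_of_set (r ` S) ! (k - 1)"
    have card_rS: "card (r ` S) = card S"
      using inj by (rule card_image)
    have "p \<in> set (sorted_list_of_set (r ` S))"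
      unfolding p_def using True k by (intro nth_mem) (simp add: card_rS)
    then have p: "p \<in> {1..N}"
      using fin rS by auto
    have "values_desc (\<lambda>i. tent b d i m) S = map t (sorted_list_of_set (r ` S))"
      using S rS by (intro values_desc_eq_map fin inj t_r)
        (auto simp: t_def subset_iff intro!: sorted_tent_antimono)
    then have "landscape_game b d k m S = t p"
      using True k by (simp add: landscape_game_def p_def card_rS)
    \<comment> \<open>The convention that \<open>sorted_tent\<close> is 0 at \<open>N + 1\<close>
      closes the telescope.\<close>
    also have "\<dots> = t p - t (Suc N)"
      by (simp add: t_def sorted_tent_def)
    also have "\<dots> = (\<Sum>j = p..N. t j - t (Suc j))"
      using p sum_Suc_diff[of p N "\<lambda>j. - t j"] by simp
    also have "\<dots> = (\<Sum>j = 1..N. (t j - t (Suc j)) * of_bool (p \<le> j))"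
      using p by (intro sum.mono_neutral_cong_left) auto
    also have "\<dots> = (\<Sum>j = 1..N. (t j - t (Suc j)) *
        of_bool (k \<le> card (S \<inter> {i \<in> {1..N}. r i \<le> j})))"
    proof -
      have "p \<le> j \<longleftrightarrow> k \<le> card (S \<inter> {i \<in> {1..N}. r i \<le> j})" for j
        unfolding p_def using True k fin
        by (subst nth_sorted_list_of_set_le_iff) (auto simp: card_rS card_le)
      then show ?thesis by simp
    qed
    finally show ?thesis by (simp add: t_def)
  qed
qed

theorem theorem3p3:
  fixes N k :: nat and b d :: "nat \<Rightarrow> real" and m :: real and r :: "nat \<Rightarrow> nat"
  assumes "persistence_diagram N b d"
    and "k \<ge> 1"
    and "tent_ranking N b d m r"
  shows "\<forall>i\<in>{1..N}. shapley_value N (landscape_game b d k m) i =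
    (\<Sum>j = max (r i) k..N. (sorted_tent N b d m j - sorted_tent N b d m (j + 1)) / real j)"
proof
  fix i assume i: "i \<in> {1..N}"
  define c where "c j = sorted_tent N b d m j - sorted_tent N b d m (j + 1)" for j
  define T where "T j = {i \<in> {1..N}. r i \<le> j}" for j
  have r: "inj_on r {1..N}" "r ` {1..N} = {1..N}"
    using assms(3) by (auto simp: tent_ranking_def bij_betw_def)
  \<comment> \<open>\<open>T j\<close> is cut out by rank rather than by value, so ties cannot
    change its size.\<close>
  have card_T: "card (T j) = j" if "j \<in> {1..N}" for j
  proof -
    have "r ` T j = {x \<in> r ` {1..N}. x \<le> j}"
      by (auto simp: T_def)
    also have "\<dots> = {1..j}"
      using that unfolding r(2) by auto
    finally have "card (r ` T j) = j" by simp
    moreover have "inj_on r (T j)"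
      using r(1) by (rule inj_on_subset) (auto simp: T_def)
    ultimately show ?thesis by (simp add: card_image)
  qed
  have "shapley_value N (landscape_game b d k m) i =
      shapley_value N (\<lambda>S. \<Sum>j = 1..N. c j * of_bool (k \<le> card (S \<inter> T j))) i"
    using landscape_game_eq_sum_quota_games[OF assms(3,2)]
    by (intro shapley_value_cong[OF i]) (simp add: c_def T_def)
  also have "\<dots> = (\<Sum>j = 1..N. c j * (if i \<in> T j \<and> k \<le> card (T j) then 1 / real (card (T j)) else 0))"
    unfolding shapley_value_sum[OF i]
    by (intro sum.cong refl arg_cong2[where f = "(*)"] shapley_value_quota_game i assms(2))
      (auto simp: T_def)
  \<comment> \<open>A quota game contributes iff \<open>r i \<le> j\<close> and
    \<open>k \<le> j\<close>, whence the lower limit; \<open>k \<ge> 1\<close> keeps the new range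
    inside \<open>{1..N}\<close>.\<close>
  also have "\<dots> = (\<Sum>j = max (r i) k..N. c j / real j)"
  proof -
    have "i \<in> T j \<longleftrightarrow> r i \<le> j" for j
      using i by (simp add: T_def)
    then show ?thesis
      using assms(2) by (intro sum.mono_neutral_cong_right) (auto simp: card_T)
  qed
  finally show "shapley_value N (landscape_game b d k m) i =
    (\<Sum>j = max (r i) k..N. (sorted_tent N b d m j - sorted_tent N b d m (j + 1)) / real j)"
    by (simp add: c_def)
qed

end
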